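(* Let $H$ and $F$ be graphs with chromatic numbers $r+1$ and $s+1$ respectively, where $r \geqslant 1$ and $s \geqslant 1$. Then, as $n \to \infty$ with $H$ and $F$ fixed, \[ \operatorname{ex}(n, \{H, F\textnormal{-ind}\}) = \begin{cases} \bigl(1 - \tfrac{1}{r} + o(1)\bigr) \binom{n}{2} & \text{if } s \geqslant r \text{ or } F \text{ is not complete multipartite}, \\ \bigl(1 - \tfrac{1}{s} + o(1)\bigr) \binom{n}{2} & \text{if } s < r \text{ and } F \text{ is complete multipartite}. \end{cases} \]
   Context: All graphs are finite and simple. For a positive integer $n$ and graphs $H$ and $F$, the induced Turán number $\operatorname{ex}(n, \{H, F\textnormal{-ind}\})$ is the maximum number of edges in an $n$-vertex graph that contains no copy of $H$ (as a not necessarily induced subgraph) and no induced copy of $F$ (i.e. no induced subgraph isomorphic to $F$). A graph is complete multipartite if its vertex set can be partitioned into non-empty parts such that two distinct vertices are adjacent if and only if they lie in different parts; the number of parts is then equal to the chromatic number. The term $o(1)$ denotes a quantity (depending on $H$, $F$ and $n$) that tends to $0$ as $n \to \infty$ for fixed $H$ and $F$. *)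

theory Defs
  imports Complex_Main "HOL-Library.Disjoint_Sets" "HOL-Library.Landau_Symbols"
begin

type_synonym 'a sgraph = "'a set \<times> 'a set set"

abbreviation verts :: "'a sgraph \<Rightarrow> 'a set" where
  "verts G \<equiv> fst G"

abbreviation edges :: "'a sgraph \<Rightarrow> 'a set set" where
  "edges G \<equiv> snd G"

definition simple_graph :: "'a sgraph \<Rightarrow> bool" where
  "simple_graph G \<longleftrightarrow> finite (verts G) \<and> (\<forall>e\<in>edges G. e \<subseteq> verts G \<and> card e = 2)"

(* In a simple graph, adj G u v implies u \<noteq> v, since edges have exactly two elements. *)
definition adj :: "'a sgraph \<Rightarrow> 'a \<Rightarrow> 'a \<Rightarrow> bool" where
  "adj G u v \<longleftrightarrow> {u, v} \<in> edges G"

definition graph_iso :: "'a sgraph \<Rightarrow> 'b sgraph \<Rightarrow> bool" where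
  "graph_iso G K \<longleftrightarrow>
     (\<exists>f. bij_betw f (verts G) (verts K) \<and>
          (\<forall>u\<in>verts G. \<forall>v\<in>verts G. adj G u v \<longleftrightarrow> adj K (f u) (f v)))"

definition subgraph_of :: "'a sgraph \<Rightarrow> 'a sgraph \<Rightarrow> bool" where
  "subgraph_of K G \<longleftrightarrow> simple_graph K \<and> verts K \<subseteq> verts G \<and> edges K \<subseteq> edges G"

definition induced_on :: "'a sgraph \<Rightarrow> 'a set \<Rightarrow> 'a sgraph" where
  "induced_on G S = (S, {e \<in> edges G. e \<subseteq> S})"

definition contains_copy :: "'a sgraph \<Rightarrow> 'b sgraph \<Rightarrow> bool" where
  "contains_copy G H \<longleftrightarrow> (\<exists>K. subgraph_of K G \<and> graph_iso H K)"

definition contains_induced_copy :: "'a sgraph \<Rightarrow> 'b sgraph \<Rightarrow> bool" where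
  "contains_induced_copy G F \<longleftrightarrow> (\<exists>S\<subseteq>verts G. graph_iso F (induced_on G S))"

definition proper_coloring :: "'a sgraph \<Rightarrow> nat \<Rightarrow> ('a \<Rightarrow> nat) \<Rightarrow> bool" where
  "proper_coloring G k c \<longleftrightarrow>
     c ` verts G \<subseteq> {..<k} \<and> (\<forall>u\<in>verts G. \<forall>v\<in>verts G. adj G u v \<longrightarrow> c u \<noteq> c v)"

definition chromatic_number :: "'a sgraph \<Rightarrow> nat" where
  "chromatic_number G = (LEAST k. \<exists>c. proper_coloring G k c)"

definition complete_multipartite :: "'a sgraph \<Rightarrow> bool" where
  "complete_multipartite G \<longleftrightarrow>
     (\<exists>P. partition_on (verts G) P \<and>
          (\<forall>u\<in>verts G. \<forall>v\<in>verts G. u \<noteq> v \<longrightarrow>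
             (adj G u v \<longleftrightarrow> \<not> (\<exists>A\<in>P. u \<in> A \<and> v \<in> A))))"

(* Host graphs live on natural numbers: every n-vertex graph is isomorphic to one of these.
   The set is finite (at most n choose 2 edges), and it is non-empty as soon as H and F
   both have an edge, because the edgeless n-vertex graph then qualifies. *)
definition induced_turan :: "nat \<Rightarrow> 'a sgraph \<Rightarrow> 'b sgraph \<Rightarrow> nat" where
  "induced_turan n H F =
     Max {card (edges G) | G :: nat sgraph.
            simple_graph G \<and> card (verts G) = n \<and>
            \<not> contains_copy G H \<and> \<not> contains_induced_copy G F}"

end

theory Submission imports Defs "HOL-Library.Ramsey" begin

text \<open>
Let \<open>k = s\<close> if \<open>s < r\<close> and \<open>F\<close> is complete multipartite, and \<open>k = r\<close> otherwise. The extremal graphs are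
asymptotically the balanced complete \<open>k\<close>-partite graphs, the Turan graphs.

For the lower bound, a Turan graph with \<open>k\<close> classes is \<open>k\<close>-colourable, so it contains no copy of a graph
of larger chromatic number. This excludes \<open>H\<close>, because \<open>k \<le> r\<close>, and it excludes \<open>F\<close> if \<open>k \<le> s\<close>. In the
remaining case \<open>F\<close> is not complete multipartite; then \<open>F\<close> cannot occur as an induced subgraph, since
induced subgraphs of complete multipartite graphs are complete multipartite
(\<open>turan_graph_no_copy\<close>, \<open>turan_graph_no_induced_copy\<close>).

For the upper bound, a graph whose edge density exceeds \<open>1 - 1 / k\<close> by a fixed amount contains, if it is
large, \<open>k + 1\<close> classes of any prescribed size such that any two vertices in different classes are adjacent
(\<open>erdos_stone\<close>). If \<open>k = r\<close>, then \<open>H\<close> embeds into these classes along a colouring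
(\<open>contains_copy_of_blowup\<close>). If \<open>k = s < r\<close>, edges inside the classes might destroy an induced copy of
\<open>F\<close>. In a graph without \<open>H\<close>, however, large cliques are absent, so by Ramsey's theorem each class
contains a large independent set (\<open>blowup_with_independent_parts\<close>). A complete multipartite \<open>F\<close> with
\<open>s + 1\<close> classes embeds into these independent sets as an induced subgraph
(\<open>contains_induced_copy_of_blowup\<close>).

The Erdos--Stone theorem is first proved for graphs of large minimum degree, by induction on the number
of classes (\<open>blowup_of_min_degree\<close>): many vertices have many neighbours in each class found so far, and
the pigeonhole principle finds a new class among them. Graphs of large edge density are reduced to this case by
deleting vertices of low degree (\<open>card_edges_le_of_low_degree_vertices\<close>).
\<close>

section \<open>Neighbourhoods and complete partite configurations\<close>
definition nbrs :: "'a sgraph \<Rightarrow> 'a set \<Rightarrow> 'a \<Rightarrow> 'a set" where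
  "nbrs G S v = {u\<in>S. adj G v u}"

text \<open>
The sets \<open>A 0, \<dots>, A (k - 1)\<close> are the classes of a (not necessarily induced) copy of the complete
\<open>k\<close>-partite graph with classes of size \<open>t\<close> inside \<open>S\<close>. In a simple graph they are automatically
disjoint, because a common vertex of two classes would be adjacent to itself. An explicit family is
used instead of a copy of a fixed graph because the proofs shrink the classes one by one.
\<close>
definition blowup :: "'a sgraph \<Rightarrow> 'a set \<Rightarrow> nat \<Rightarrow> nat \<Rightarrow> (nat \<Rightarrow> 'a set) \<Rightarrow> bool" where
  "blowup G S k t A \<longleftrightarrow> (\<forall>i<k. A i \<subseteq> S \<and> card (A i) = t) \<and>
     (\<forall>i<k. \<forall>j<k. i \<noteq> j \<longrightarrow> (\<forall>a\<in>A i. \<forall>b\<in>A j. adj G a b))"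

lemma adj_sym: "adj G u v \<longleftrightarrow> adj G v u"
  by (simp add: adj_def insert_commute)

lemma adj_irrefl: "simple_graph G \<Longrightarrow> \<not> adj G v v"
  by (auto simp: adj_def simple_graph_def)

lemma finite_verts: "simple_graph G \<Longrightarrow> finite (verts G)"
  by (simp add: simple_graph_def)

lemma finite_edges: "simple_graph G \<Longrightarrow> finite (edges G)"
  unfolding simple_graph_def by (meson PowI finite_Pow_iff finite_subset subsetI)

lemma blowup_mono: "blowup G S k t A \<Longrightarrow> S \<subseteq> S' \<Longrightarrow> blowup G S' k t A"
  unfolding blowup_def by blast

section \<open>The minimum degree form of the Erdos--Stone theorem\<close>

text \<open>
Both sides count the ordered adjacent pairs between \<open>A\<close> and \<open>B\<close>.
\<close>
lemma sum_card_nbrs_swap: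
  assumes "finite A" "finite B"
  shows "(\<Sum>a\<in>A. card (nbrs G B a)) = (\<Sum>b\<in>B. card (nbrs G A b))"
proof -
  have *: "card (nbrs G Y x) = (\<Sum>y\<in>Y. if adj G x y then 1 else 0)" if "finite Y" for Y x
    using that by (simp add: nbrs_def sum.If_cases Int_def)
  have "(\<Sum>a\<in>A. card (nbrs G B a)) = (\<Sum>b\<in>B. \<Sum>a\<in>A. if adj G a b then 1 else 0)"
    by (simp add: * assms sum.swap[of _ A B])
  also have "\<dots> = (\<Sum>b\<in>B. card (nbrs G A b))"
    by (simp add: * assms adj_sym)
  finally show ?thesis .
qed

text \<open>
The counting step of the induction on the number of classes. A vertex with fewer than \<open>t\<close> neighbours
in some class sends fewer than \<open>r T + t\<close> edges to the union of the \<open>r + 1\<close> classes, whereas the degree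
hypothesis forces \<open>(r + \<epsilon>) T\<close> edges on average. For \<open>T\<close> large compared with \<open>t / \<epsilon>\<close> the gap can only be
filled by a linear number of vertices that have \<open>t\<close> neighbours in every class.
\<close>
lemma many_vertices_joined_to_all_parts:
  fixes \<epsilon> :: real
  assumes S: "finite S"
    and A: "\<And>i. i < Suc r \<Longrightarrow> A i \<subseteq> S" "\<And>i. i < Suc r \<Longrightarrow> card (A i) = T"
    and deg: "\<And>v. v \<in> S \<Longrightarrow> (real r + \<epsilon>) * card S \<le> real (Suc r) * card (nbrs G S v)"
    and T: "0 < T" "2 * real t \<le> \<epsilon> * T"
  shows "\<epsilon> * card S \<le> 2 * real (card {v\<in>S. \<forall>i<Suc r. t \<le> card (nbrs G (A i) v)})"
proof -
  let ?W = "{v\<in>S. \<forall>i<Suc r. t \<le> card (nbrs G (A i) v)}"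
  let ?n = "card S"
  have finA: "finite (A i)" if "i < Suc r" for i
    using A(1)[OF that] S finite_subset by blast
  have le_T: "card (nbrs G (A i) v) \<le> T" if "i < Suc r" for i v
    using card_mono[OF finA[OF that], of "nbrs G (A i) v"] A(2)[OF that] by (auto simp: nbrs_def)
  have upper: "(\<Sum>i<Suc r. card (nbrs G (A i) v)) \<le> r * T + t + (if v \<in> ?W then T else 0)"
    if "v \<in> S" for v
  proof (cases "v \<in> ?W")
    case True
    have "(\<Sum>i<Suc r. card (nbrs G (A i) v)) \<le> (\<Sum>i<Suc r. T)"
      by (rule sum_mono) (simp add: le_T)
    then show ?thesis using True by (simp add: algebra_simps)
  next
    case False
    then obtain i where i: "i < Suc r" "card (nbrs G (A i) v) < t"
      using \<open>v \<in> S\<close> by auto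
    have "(\<Sum>j<Suc r. card (nbrs G (A j) v))
        = card (nbrs G (A i) v) + (\<Sum>j\<in>{..<Suc r} - {i}. card (nbrs G (A j) v))"
      using i by (intro sum.remove) auto
    also have "\<dots> \<le> t + (\<Sum>j\<in>{..<Suc r} - {i}. T)"
      using i by (intro add_mono sum_mono le_T) auto
    also have "\<dots> = t + r * T" using i by simp
    finally show ?thesis using False by (simp only: if_False)
  qed
  have "(\<Sum>i<Suc r. \<Sum>a\<in>A i. card (nbrs G S a)) = (\<Sum>i<Suc r. \<Sum>v\<in>S. card (nbrs G (A i) v))"
    using S finA by (intro sum.cong refl sum_card_nbrs_swap) auto
  also have "\<dots> = (\<Sum>v\<in>S. \<Sum>i<Suc r. card (nbrs G (A i) v))"
    by (rule sum.swap)
  also have "\<dots> \<le> (\<Sum>v\<in>S. r * T + t + (if v \<in> ?W then T else 0))"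
    by (rule sum_mono) (rule upper)
  also have "\<dots> = ?n * (r * T + t) + card ?W * T"
    using S by (simp add: sum.distrib sum.If_cases Int_def del: sum.lessThan_Suc)
  finally have up: "(\<Sum>i<Suc r. \<Sum>a\<in>A i. card (nbrs G S a)) \<le> ?n * (r * T + t) + card ?W * T" .
  have "T * ((real r + \<epsilon>) * ?n) = (\<Sum>i<Suc r. \<Sum>a\<in>A i. (real r + \<epsilon>) * ?n / Suc r)"
    using A(2) by (simp add: field_simps del: sum.lessThan_Suc of_nat_Suc)
  also have "\<dots> \<le> (\<Sum>i<Suc r. \<Sum>a\<in>A i. real (card (nbrs G S a)))"
  proof (intro sum_mono)
    fix i a assume "i \<in> {..<Suc r}" "a \<in> A i"
    then have "a \<in> S" using A(1) by blast
    then show "(real r + \<epsilon>) * ?n / Suc r \<le> real (card (nbrs G S a))"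
      using deg[of a] by (simp add: field_simps)
  qed
  also have "\<dots> = real (\<Sum>i<Suc r. \<Sum>a\<in>A i. card (nbrs G S a))" by simp
  also have "\<dots> \<le> real (?n * (r * T + t) + card ?W * T)" using up of_nat_mono by blast
  finally have "T * ((real r + \<epsilon>) * ?n) \<le> ?n * (r * T + real t) + card ?W * T" by simp
  then have "2 * (\<epsilon> * T) * ?n \<le> 2 * real t * ?n + 2 * card ?W * T" by (simp add: algebra_simps)
  moreover have "2 * real t * ?n \<le> \<epsilon> * T * ?n" using T(2) by (intro mult_right_mono) auto
  ultimately have "T * (\<epsilon> * ?n) \<le> T * (2 * real (card ?W))" by (simp add: algebra_simps)
  then show ?thesis using T(1) by simp
qed

text \<open>
Each of the linearly many vertices \<open>v\<close> above selects \<open>t\<close> neighbours in every class. The number of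
possible selections depends on \<open>T\<close> and \<open>r\<close> only, so if \<open>S\<close> is large, some \<open>t\<close> vertices make the same
selection; they form the new class, and the common selection replaces the old classes.
\<close>
lemma blowup_extend:
  fixes \<epsilon> :: real
  assumes S: "finite S" and A: "blowup G S (Suc r) T A"
    and deg: "\<And>v. v \<in> S \<Longrightarrow> (real r + \<epsilon>) * card S \<le> real (Suc r) * card (nbrs G S v)"
    and T: "0 < T" "2 * real t \<le> \<epsilon> * T"
    and large: "2 * real ((2 ^ T) ^ Suc r * t) \<le> \<epsilon> * card S"
  shows "\<exists>B. blowup G S (Suc (Suc r)) t B"
proof -
  let ?W = "{v\<in>S. \<forall>i<Suc r. t \<le> card (nbrs G (A i) v)}"
  let ?P = "PiE {..<Suc r} (\<lambda>i. Pow (A i))"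
  have A': "A i \<subseteq> S" "card (A i) = T" if "i < Suc r" for i
    using A that by (auto simp: blowup_def)
  have finA: "finite (A i)" if "i < Suc r" for i
    using A'(1)[OF that] S finite_subset by blast
  have "\<epsilon> * card S \<le> 2 * real (card ?W)"
    by (rule many_vertices_joined_to_all_parts[OF S A' deg T])
  with large have W_large: "(2 ^ T) ^ Suc r * t \<le> card ?W"
    unfolding of_nat_le_iff[symmetric, where ?'a = real] by linarith
  define C where "C v i = (SOME C. C \<subseteq> nbrs G (A i) v \<and> card C = t)" for v i
  have C: "C v i \<subseteq> nbrs G (A i) v" "card (C v i) = t" if "v \<in> ?W" "i < Suc r" for v i
  proof -
    have "t \<le> card (nbrs G (A i) v)" using that by blast
    then have "\<exists>C. C \<subseteq> nbrs G (A i) v \<and> card C = t"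
      using obtain_subset_with_card_n by blast
    from someI_ex[OF this] show "C v i \<subseteq> nbrs G (A i) v" "card (C v i) = t"
      by (simp_all add: C_def)
  qed
  \<comment> \<open>Restricting makes selections elements of a finite product, as the pigeonhole principle requires.\<close>
  define f where "f v = restrict (C v) {..<Suc r}" for v
  have finP: "finite ?P" by (rule finite_PiE) (auto simp: finA)
  have cardP: "card ?P = (2 ^ T) ^ Suc r"
    by (simp add: card_PiE card_Pow finA A'(2) del: prod.lessThan_Suc)
  have fP: "f v \<in> ?P" if "v \<in> ?W" for v
  proof -
    have "C v i \<subseteq> A i" if "i < Suc r" for i
      using C(1)[OF \<open>v \<in> ?W\<close> that] by (auto simp: nbrs_def)
    then show ?thesis by (auto simp: f_def PiE_iff)
  qed
  have "?P \<noteq> {}" using cardP by (metis card.empty power_not_zero zero_neq_numeral)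
  then obtain y where y: "y \<in> ?P" "card ?W \<le> card (f -` {y} \<inter> ?W) * card ?P"
    using pigeonhole_card[of f ?W ?P] fP finP S by auto
  have "(2 ^ T) ^ Suc r * t \<le> (2 ^ T) ^ Suc r * card (f -` {y} \<inter> ?W)"
    using order_trans[OF W_large y(2)] unfolding cardP mult.commute[of "card _"] .
  then have "t \<le> card (f -` {y} \<inter> ?W)"
    unfolding mult_le_cancel1 by simp
  then obtain X where X: "X \<subseteq> f -` {y} \<inter> ?W" "card X = t"
    by (rule obtain_subset_with_card_n)
  show ?thesis
  proof (cases "t = 0")
    case True
    then show ?thesis by (intro exI[of _ "\<lambda>_. {}"]) (simp add: blowup_def)
  next
    case False
    then obtain w where w: "w \<in> X" using X(2) by fastforce
    have y_eq: "y i = C v i" if "v \<in> X" "i < Suc r" for v i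
      using X(1) that by (auto simp: f_def)
    have yA: "y i \<subseteq> A i" if "i < Suc r" for i
      using y(1) that by (auto simp: PiE_iff)
    have yt: "card (y i) = t" if "i < Suc r" for i
      using C(2)[of w i] y_eq[OF w that] X(1) w that by auto
    have Xadj: "adj G v a" if "v \<in> X" "i < Suc r" "a \<in> y i" for v i a
      using C(1)[of v i] y_eq[OF that(1,2)] X(1) that by (auto simp: nbrs_def)
    define B where "B i = (if i < Suc r then y i else X)" for i
    have "B i \<subseteq> S \<and> card (B i) = t" for i
    proof (cases "i < Suc r")
      case True
      then show ?thesis using yA[OF True] yt A'(1)[OF True] by (simp add: B_def)
    next
      case False
      then show ?thesis using X by (auto simp: B_def)
    qed
    moreover have "adj G a b" if "i < Suc (Suc r)" "j < Suc (Suc r)" "i \<noteq> j" and ab: "a \<in> B i" "b \<in> B j"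
      for i j a b
    proof -
      consider "i < Suc r" "j < Suc r" | "i < Suc r" "j = Suc r" | "i = Suc r" "j < Suc r"
        using \<open>i < Suc (Suc r)\<close> \<open>j < Suc (Suc r)\<close> \<open>i \<noteq> j\<close> by linarith
      then show ?thesis
      proof cases
        case 1
        then have "a \<in> A i" "b \<in> A j" using ab yA by (auto simp: B_def)
        then show ?thesis using A 1 \<open>i \<noteq> j\<close> unfolding blowup_def by blast
      next
        case 2
        then have "b \<in> X" "a \<in> y i" using ab by (simp_all add: B_def)
        then show ?thesis using Xadj[of b i a] 2 by (simp add: adj_sym)
      next
        case 3
        then have "a \<in> X" "b \<in> y j" using ab by (simp_all add: B_def)
        then show ?thesis using Xadj[of a j b] 3 by simp
      qed
    qed
    ultimately have "blowup G S (Suc (Suc r)) t B" unfolding blowup_def by blast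
    then show ?thesis by blast
  qed
qed

text \<open>
The bound on the degrees is written without division so that the induction can start at \<open>r = 0\<close>, where
a single class of size \<open>t\<close> is wanted and any \<open>t\<close> vertices will do.
\<close>
lemma blowup_of_min_degree:
  fixes \<epsilon> :: real
  assumes "0 < \<epsilon>"
  shows "\<exists>N. \<forall>(G :: 'a sgraph) S. finite S \<longrightarrow> N \<le> card S \<longrightarrow>
    (\<forall>v\<in>S. (real r - 1 + \<epsilon>) * card S \<le> real r * card (nbrs G S v)) \<longrightarrow>
    (\<exists>A. blowup G S (Suc r) t A)"
  using assms
proof (induction r arbitrary: \<epsilon> t)
  case 0
  have "\<exists>A. blowup G S (Suc 0) t A" if ct: "t \<le> card S" for G :: "'a sgraph" and S
  proof -
    obtain C where "C \<subseteq> S" "card C = t" using obtain_subset_with_card_n[OF ct] by blast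
    then have "blowup G S (Suc 0) t (\<lambda>_. C)" by (simp add: blowup_def)
    then show ?thesis by blast
  qed
  then show ?case by blast
next
  case (Suc r)
  define T where "T = nat \<lceil>2 * real t / \<epsilon>\<rceil> + 1"
  have "2 * real t / \<epsilon> \<le> T" unfolding T_def by linarith
  then have T: "0 < T" "2 * real t \<le> \<epsilon> * T"
    using \<open>0 < \<epsilon>\<close> by (simp_all add: T_def field_simps)
  \<comment> \<open>The degree condition for \<open>r + 1\<close> exceeds the one for \<open>r\<close> by a margin of \<open>1 / (r + 1)\<close>, whatever \<open>\<epsilon>\<close> is.\<close>
  obtain N0 where N0: "\<exists>A. blowup G S (Suc r) T A"
    if "finite S" "N0 \<le> card S"
      "\<forall>v\<in>S. (real r - 1 + 1 / Suc r) * card S \<le> real r * card (nbrs G S v)"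
    for G :: "'a sgraph" and S
    using Suc.IH[of "1 / Suc r" T] by auto
  define M where "M = (2 ^ T) ^ Suc r * t"
  define N where "N = max N0 (nat \<lceil>2 * real M / \<epsilon>\<rceil>)"
  have "\<exists>A. blowup G S (Suc (Suc r)) t A"
    if S: "finite S" "N \<le> card S"
      and deg: "\<forall>v\<in>S. (real (Suc r) - 1 + \<epsilon>) * card S \<le> real (Suc r) * card (nbrs G S v)"
    for G :: "'a sgraph" and S
  proof -
    have deg': "(real r + \<epsilon>) * card S \<le> real (Suc r) * card (nbrs G S v)" if "v \<in> S" for v
      using deg that by simp
    have "(real r - 1 + 1 / Suc r) * card S \<le> real r * card (nbrs G S v)" if "v \<in> S" for v
    proof -
      have "Suc r * ((real r - 1 + 1 / Suc r) * card S) = real r * (real r * card S)"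
        by (simp add: field_simps)
      also have "\<dots> \<le> real r * ((real r + \<epsilon>) * card S)"
        using \<open>0 < \<epsilon>\<close> by (intro mult_left_mono mult_right_mono) auto
      also have "\<dots> \<le> real r * (real (Suc r) * card (nbrs G S v))"
        by (rule mult_left_mono[OF deg'[OF that]]) simp
      finally have "Suc r * ((real r - 1 + 1 / Suc r) * card S)
          \<le> Suc r * (real r * card (nbrs G S v))" by (simp only: mult_ac)
      then show ?thesis by (subst (asm) mult_le_cancel_left_pos) auto
    qed
    moreover have "N0 \<le> card S" using S(2) by (simp add: N_def)
    ultimately obtain A where A: "blowup G S (Suc r) T A"
      using N0[OF S(1)] by blast
    have "2 * real M / \<epsilon> \<le> N" unfolding N_def by linarith
    also have "\<dots> \<le> card S" using S(2) by simp
    finally have "2 * real M \<le> \<epsilon> * card S" using \<open>0 < \<epsilon>\<close> by (simp add: field_simps)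
    then show ?thesis
      using blowup_extend[OF S(1) A deg' T] by (simp add: M_def)
  qed
  then show ?case by blast
qed


section \<open>The edge density form of the Erdos--Stone theorem\<close>
lemma of_nat_choose_two: "real (n choose 2) = real n * (real n - 1) / 2"
proof (induction n)
  case (Suc n)
  have "Suc n choose 2 = n + (n choose 2)" by (simp add: numeral_2_eq_2)
  then show ?case using Suc by (simp add: field_simps)
qed simp

lemma card_edges_le_choose_two:
  assumes "simple_graph G"
  shows "card (edges G) \<le> card (verts G) choose 2"
proof -
  have "card (edges G) \<le> card {e. e \<subseteq> verts G \<and> card e = 2}"
    using assms by (intro card_mono) (auto simp: simple_graph_def)
  then show ?thesis by (simp add: n_subsets finite_verts[OF assms])
qed

lemma simple_graph_induced_on:
  "simple_graph G \<Longrightarrow> S \<subseteq> verts G \<Longrightarrow> simple_graph (induced_on G S)"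
  by (auto simp: simple_graph_def induced_on_def finite_subset)

lemma card_edges_delete_vertex:
  assumes "simple_graph G" "S \<subseteq> verts G"
  shows "card (edges (induced_on G S)) \<le> card (edges (induced_on G (S - {v}))) + card (nbrs G S v)"
proof -
  have fin: "finite (edges G)" "finite S"
    using finite_edges[OF assms(1)] finite_subset[OF assms(2) finite_verts[OF assms(1)]] .
  have "edges (induced_on G S) \<subseteq> edges (induced_on G (S - {v})) \<union> (\<lambda>u. {v, u}) ` nbrs G S v"
  proof
    fix e assume e: "e \<in> edges (induced_on G S)"
    show "e \<in> edges (induced_on G (S - {v})) \<union> (\<lambda>u. {v, u}) ` nbrs G S v"
    proof (cases "v \<in> e")
      case True
      have "card e = 2" using e assms(1) by (auto simp: induced_on_def simple_graph_def)
      then obtain u where "e = {v, u}" using True by (auto simp: card_2_iff)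
      then show ?thesis using e by (auto simp: induced_on_def nbrs_def adj_def)
    qed (use e in \<open>auto simp: induced_on_def\<close>)
  qed
  then have "card (edges (induced_on G S))
      \<le> card (edges (induced_on G (S - {v})) \<union> (\<lambda>u. {v, u}) ` nbrs G S v)"
    using fin by (intro card_mono) (auto simp: induced_on_def nbrs_def)
  also have "\<dots> \<le> card (edges (induced_on G (S - {v}))) + card ((\<lambda>u. {v, u}) ` nbrs G S v)"
    by (rule card_Un_le)
  also have "\<dots> \<le> card (edges (induced_on G (S - {v}))) + card (nbrs G S v)"
    using fin by (intro add_left_mono card_image_le) (auto simp: nbrs_def)
  finally show ?thesis .
qed

text \<open>
If every large vertex set spans a vertex of relative degree at most \<open>\<alpha>\<close>, such vertices can be deleted
one at a time until fewer than \<open>N\<close> remain. Deleting a vertex from a set of size \<open>m\<close> loses at most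
\<open>\<alpha> m\<close> edges, and these losses add up to \<open>\<alpha>\<close> times a triangular number.
\<close>
lemma card_edges_le_of_low_degree_vertices:
  fixes \<alpha> :: real
  assumes G: "simple_graph G" and \<alpha>: "0 \<le> \<alpha>" and S: "S \<subseteq> verts G"
    and low: "\<And>S'. S' \<subseteq> verts G \<Longrightarrow> N \<le> card S' \<Longrightarrow> \<exists>v\<in>S'. card (nbrs G S' v) \<le> \<alpha> * card S'"
  shows "card (edges (induced_on G S)) \<le> (real N)\<^sup>2 + \<alpha> * (Suc (card S) choose 2)"
  using S
proof (induction "card S" arbitrary: S rule: less_induct)
  case less
  have fin: "finite S" using finite_subset[OF less.prems finite_verts[OF G]] .
  show ?case
  proof (cases "N \<le> card S")
    case True
    then obtain v where v: "v \<in> S" "card (nbrs G S v) \<le> \<alpha> * card S"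
      using low less.prems by blast
    then obtain m where m: "card S = Suc m" "card (S - {v}) = m"
      using fin by (metis card_Suc_Diff1)
    have "real (card (edges (induced_on G S)))
        \<le> card (edges (induced_on G (S - {v}))) + card (nbrs G S v)"
      using card_edges_delete_vertex[OF G less.prems] of_nat_mono by blast
    also have "\<dots> \<le> (real N)\<^sup>2 + \<alpha> * (Suc m choose 2) + \<alpha> * Suc m"
      using less.hyps[of "S - {v}"] less.prems m v by fastforce
    also have "\<dots> = (real N)\<^sup>2 + \<alpha> * (Suc (Suc m) choose 2)"
      by (simp add: of_nat_choose_two field_simps)
    finally show ?thesis by (simp add: m)
  next
    case False
    have "real (card (edges (induced_on G S))) \<le> (card S choose 2)"
      using card_edges_le_choose_two[OF simple_graph_induced_on[OF G less.prems]]
      by (simp add: induced_on_def)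
    also have "\<dots> \<le> real (card S) * real (card S)"
      by (simp add: of_nat_choose_two field_simps)
    also have "\<dots> \<le> (real N)\<^sup>2"
      unfolding power2_eq_square using False by (intro mult_mono) auto
    finally show ?thesis using \<alpha> by (simp add: add_increasing2)
  qed
qed

text \<open>
In a graph without the configuration every large vertex set contains a vertex of relative degree at
most \<open>1 - 1 / r + \<delta> / 2\<close>, by the minimum degree form. Hence deleting vertices of low degree bounds the
number of edges; the other \<open>\<delta> / 2\<close> absorbs the lower order terms.
\<close>
theorem erdos_stone:
  fixes \<delta> :: real
  assumes r: "1 \<le> r" and \<delta>: "0 < \<delta>"
  shows "\<exists>N. \<forall>G :: 'a sgraph. simple_graph G \<longrightarrow> N \<le> card (verts G) \<longrightarrow>
    (\<nexists>A. blowup G (verts G) (Suc r) t A) \<longrightarrow>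
    card (edges G) \<le> (1 - 1 / r + \<delta>) * (card (verts G) choose 2)"
proof -
  define \<alpha> where "\<alpha> = 1 - 1 / r + \<delta> / 2"
  have \<alpha>: "0 \<le> \<alpha>" using r \<delta> by (simp add: \<alpha>_def)
  have "0 < r * \<delta> / 2" using r \<delta> by simp
  from blowup_of_min_degree[OF this, of r t, where ?'a = 'a]
  obtain N0 where N0: "\<exists>A. blowup G S (Suc r) t A"
    if "finite S" "N0 \<le> card S"
      "\<forall>v\<in>S. (real r - 1 + r * \<delta> / 2) * card S \<le> real r * card (nbrs G S v)"
    for G :: "'a sgraph" and S by auto
  define N where "N = nat \<lceil>4 * ((real N0)\<^sup>2 + \<alpha>) / \<delta>\<rceil> + 1"
  have "card (edges G) \<le> (1 - 1 / r + \<delta>) * (card (verts G) choose 2)"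
    if G: "simple_graph G" "N \<le> card (verts G)" and free: "\<nexists>A. blowup G (verts G) (Suc r) t A"
    for G :: "'a sgraph"
  proof -
    define n where "n = card (verts G)"
    have "\<exists>v\<in>S. card (nbrs G S v) \<le> \<alpha> * card S" if S: "S \<subseteq> verts G" "N0 \<le> card S" for S
    proof (rule ccontr)
      assume "\<not> ?thesis"
      then have high: "\<alpha> * card S \<le> card (nbrs G S v)" if "v \<in> S" for v
        using that by fastforce
      have "(real r - 1 + r * \<delta> / 2) * card S \<le> real r * card (nbrs G S v)" if "v \<in> S" for v
      proof -
        have "real r - 1 + r * \<delta> / 2 = r * \<alpha>"
          using r by (simp add: \<alpha>_def field_simps)
        then show ?thesis
          using mult_left_mono[OF high[OF that], of r] by (simp only: mult.assoc of_nat_0_le_iff)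
      qed
      moreover have "finite S" using finite_subset[OF S(1) finite_verts[OF G(1)]] .
      ultimately obtain A where "blowup G S (Suc r) t A"
        using N0[of S G] S(2) by blast
      then show False using free blowup_mono[OF _ S(1)] by blast
    qed
    then have "card (edges (induced_on G (verts G))) \<le> (real N0)\<^sup>2 + \<alpha> * (Suc n choose 2)"
      unfolding n_def using G(1) \<alpha>
      by (intro card_edges_le_of_low_degree_vertices) auto
    moreover have "edges (induced_on G (verts G)) = edges G"
      using G(1) by (auto simp: induced_on_def simple_graph_def)
    ultimately have "card (edges G) \<le> (real N0)\<^sup>2 + \<alpha> * n + \<alpha> * (n choose 2)"
      by (simp add: of_nat_choose_two field_simps)
    moreover have "(real N0)\<^sup>2 + \<alpha> * n \<le> \<delta> / 2 * (n choose 2)"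
    proof -
      have n: "1 \<le> real n" "4 * ((real N0)\<^sup>2 + \<alpha>) / \<delta> \<le> real n - 1"
        using G(2) unfolding n_def N_def by linarith+
      have "(real N0)\<^sup>2 * 1 \<le> (real N0)\<^sup>2 * n" using n(1) by (intro mult_left_mono) auto
      then have "(real N0)\<^sup>2 + \<alpha> * n \<le> ((real N0)\<^sup>2 + \<alpha>) * n" by (simp add: algebra_simps)
      also have "\<dots> \<le> (\<delta> / 4 * (real n - 1)) * n"
        using n \<delta> by (intro mult_right_mono) (auto simp: field_simps)
      finally show ?thesis by (simp add: of_nat_choose_two field_simps)
    qed
    ultimately have "card (edges G) \<le> (\<alpha> + \<delta> / 2) * (n choose 2)"
      by (simp add: algebra_simps)
    moreover have "\<alpha> + \<delta> / 2 = 1 - 1 / r + \<delta>" by (simp add: \<alpha>_def)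
    ultimately show ?thesis by (simp only: n_def)
  qed
  then show ?thesis by blast
qed

section \<open>Colourings and copies\<close>
lemma proper_coloring_chromatic_number:
  assumes "simple_graph G"
  shows "\<exists>c. proper_coloring G (chromatic_number G) c"
proof -
  obtain h where "bij_betw h (verts G) {0..<card (verts G)}"
    using ex_bij_betw_finite_nat[OF finite_verts[OF assms]] by blast
  moreover have "\<not> adj G v v" for v using assms by (rule adj_irrefl)
  ultimately have "proper_coloring G (card (verts G)) h"
    by (auto simp: proper_coloring_def bij_betw_def inj_on_def atLeast0LessThan)
  then have "\<exists>k c. proper_coloring G k c" by blast
  then show ?thesis unfolding chromatic_number_def by (rule LeastI_ex)
qed

lemma chromatic_number_le: "proper_coloring G k c \<Longrightarrow> chromatic_number G \<le> k"
  unfolding chromatic_number_def by (rule Least_le) blast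

lemma contains_copyI:
  assumes H: "simple_graph H" and f: "inj_on f (verts H)" "f ` verts H \<subseteq> verts G"
    and hom: "\<And>u v. u \<in> verts H \<Longrightarrow> v \<in> verts H \<Longrightarrow> adj H u v \<Longrightarrow> adj G (f u) (f v)"
  shows "contains_copy G H"
proof -
  let ?K = "(f ` verts H, (`) f ` edges H)"
  have sub: "e \<subseteq> verts H" "card e = 2" if "e \<in> edges H" for e
    using H that by (auto simp: simple_graph_def)
  have "f ` e \<in> edges G" if e: "e \<in> edges H" for e
  proof -
    obtain u v where uv: "e = {u, v}" using sub(2)[OF e] by (auto simp: card_2_iff)
    then show ?thesis using hom[of u v] sub(1)[OF e] e by (auto simp: adj_def)
  qed
  moreover have "card (f ` e) = 2" if e: "e \<in> edges H" for e
    using card_image[OF inj_on_subset[OF f(1) sub(1)[OF e]]] sub(2)[OF e] by simp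
  ultimately have "subgraph_of ?K G"
    using f(2) finite_verts[OF H] sub(1) by (auto simp: subgraph_of_def simple_graph_def image_mono)
  moreover have "adj H u v \<longleftrightarrow> adj ?K (f u) (f v)" if uv: "u \<in> verts H" "v \<in> verts H" for u v
  proof
    assume "adj H u v"
    then have "f ` {u, v} \<in> (`) f ` edges H" unfolding adj_def by (rule imageI)
    then show "adj ?K (f u) (f v)" by (simp add: adj_def)
  next
    assume "adj ?K (f u) (f v)"
    then obtain e where e: "e \<in> edges H" "f ` {u, v} = f ` e" by (auto simp: adj_def)
    have "{u, v} = e"
      using inj_on_image_eq_iff[OF f(1), of "{u, v}" e] e sub(1) uv by simp
    then show "adj H u v" using e(1) by (simp add: adj_def)
  qed
  then have "graph_iso H ?K"
    unfolding graph_iso_def using f(1) by (intro exI[of _ f]) (simp add: bij_betw_def)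
  ultimately show ?thesis unfolding contains_copy_def by blast
qed

lemma contains_copyE:
  assumes "contains_copy G H"
  obtains f where "f ` verts H \<subseteq> verts G"
    "\<And>u v. u \<in> verts H \<Longrightarrow> v \<in> verts H \<Longrightarrow> adj H u v \<Longrightarrow> adj G (f u) (f v)"
proof -
  obtain K f where K: "subgraph_of K G" and f: "bij_betw f (verts H) (verts K)"
    "\<forall>u\<in>verts H. \<forall>v\<in>verts H. adj H u v \<longleftrightarrow> adj K (f u) (f v)"
    using assms unfolding contains_copy_def graph_iso_def by blast
  show ?thesis
  proof (rule that)
    show "f ` verts H \<subseteq> verts G"
      using f(1) K by (simp add: bij_betw_def subgraph_of_def)
    show "adj G (f u) (f v)" if "u \<in> verts H" "v \<in> verts H" "adj H u v" for u v
      using f(2) that K by (auto simp: adj_def subgraph_of_def)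
  qed
qed

lemma adj_induced_on: "adj (induced_on G S) u v \<longleftrightarrow> adj G u v \<and> u \<in> S \<and> v \<in> S"
  by (auto simp: adj_def induced_on_def)

lemma contains_induced_copy_iff:
  "contains_induced_copy G F \<longleftrightarrow> (\<exists>f. inj_on f (verts F) \<and> f ` verts F \<subseteq> verts G \<and>
     (\<forall>u\<in>verts F. \<forall>v\<in>verts F. adj F u v \<longleftrightarrow> adj G (f u) (f v)))"
proof
  assume "contains_induced_copy G F"
  then obtain S f where S: "S \<subseteq> verts G" and f: "bij_betw f (verts F) S"
    "\<forall>u\<in>verts F. \<forall>v\<in>verts F. adj F u v \<longleftrightarrow> adj (induced_on G S) (f u) (f v)"
    unfolding contains_induced_copy_def graph_iso_def by (auto simp: induced_on_def)
  have "f u \<in> S" if "u \<in> verts F" for u using f(1) that by (auto simp: bij_betw_def)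
  then show "\<exists>f. inj_on f (verts F) \<and> f ` verts F \<subseteq> verts G \<and>
     (\<forall>u\<in>verts F. \<forall>v\<in>verts F. adj F u v \<longleftrightarrow> adj G (f u) (f v))"
    using f S by (intro exI[of _ f]) (auto simp: bij_betw_def adj_induced_on)
next
  assume "\<exists>f. inj_on f (verts F) \<and> f ` verts F \<subseteq> verts G \<and>
     (\<forall>u\<in>verts F. \<forall>v\<in>verts F. adj F u v \<longleftrightarrow> adj G (f u) (f v))"
  then obtain f where f: "inj_on f (verts F)" "f ` verts F \<subseteq> verts G"
    "\<forall>u\<in>verts F. \<forall>v\<in>verts F. adj F u v \<longleftrightarrow> adj G (f u) (f v)" by blast
  have "graph_iso F (induced_on G (f ` verts F))"
    unfolding graph_iso_def adj_induced_on using f(1,3)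
    by (intro exI[of _ f]) (simp add: bij_betw_def induced_on_def)
  then show "contains_induced_copy G F"
    using f(2) unfolding contains_induced_copy_def by blast
qed

section \<open>Copies inside complete partite configurations\<close>

text \<open>
Every class is as large as the whole of \<open>V\<close>, so the vertices of one colour can be placed injectively
in the class of that colour. The classes being disjoint, the placement is injective overall.
\<close>
lemma blowup_transversal_embedding:
  assumes G: "simple_graph G" and V: "finite V" and A: "blowup G (verts G) k (card V) A"
    and c: "c ` V \<subseteq> {..<k}"
  obtains f where "inj_on f V" "\<And>v. v \<in> V \<Longrightarrow> f v \<in> A (c v)"
    "\<And>u v. u \<in> V \<Longrightarrow> v \<in> V \<Longrightarrow> c u \<noteq> c v \<Longrightarrow> adj G (f u) (f v)"
proof -
  have "\<exists>g. bij_betw g V (A i)" if i: "i < k" for i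
  proof (rule finite_same_card_bij[OF V])
    have "A i \<subseteq> verts G" using A i by (simp add: blowup_def)
    then show "finite (A i)" using finite_verts[OF G] by (rule finite_subset)
    show "card V = card (A i)" using A i by (simp add: blowup_def)
  qed
  then obtain g where g: "bij_betw (g i) V (A i)" if "i < k" for i by metis
  have ck: "c v < k" if "v \<in> V" for v using c that by auto
  define f where "f v = g (c v) v" for v
  have fA: "f v \<in> A (c v)" if "v \<in> V" for v
    using bij_betw_apply[OF g[OF ck[OF that]] that] by (simp add: f_def)
  have adj: "adj G (f u) (f v)" if "u \<in> V" "v \<in> V" "c u \<noteq> c v" for u v
    using A fA[OF that(1)] fA[OF that(2)] ck[OF that(1)] ck[OF that(2)] that(3)
    unfolding blowup_def by blast
  have "inj_on f V"
  proof (rule inj_onI)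
    fix u v assume uv: "u \<in> V" "v \<in> V" "f u = f v"
    then have "c u = c v" using adj[of u v] adj_irrefl[OF G] by auto
    then show "u = v"
      using uv bij_betw_imp_inj_on[OF g[OF ck[OF uv(1)]]] by (auto simp: f_def dest: inj_onD)
  qed
  then show thesis using that fA adj by blast
qed

lemma contains_copy_of_blowup:
  assumes G: "simple_graph G" and H: "simple_graph H"
    and c: "proper_coloring H k c" and A: "blowup G (verts G) k (card (verts H)) A"
  shows "contains_copy G H"
proof -
  have ck: "c ` verts H \<subseteq> {..<k}" using c by (simp add: proper_coloring_def)
  obtain f where f: "inj_on f (verts H)" "\<And>v. v \<in> verts H \<Longrightarrow> f v \<in> A (c v)"
    "\<And>u v. u \<in> verts H \<Longrightarrow> v \<in> verts H \<Longrightarrow> c u \<noteq> c v \<Longrightarrow> adj G (f u) (f v)"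
    using blowup_transversal_embedding[OF G finite_verts[OF H] A ck] by blast
  have "f v \<in> verts G" if "v \<in> verts H" for v
    using f(2)[OF that] A ck that by (auto simp: blowup_def)
  then show ?thesis
    using f(1,3) c by (intro contains_copyI[OF H, of f]) (auto simp: proper_coloring_def)
qed

lemma contains_copy_of_clique:
  assumes H: "simple_graph H" and R: "finite R" "R \<subseteq> verts G" "card R = card (verts H)"
    and clique: "clique R (edges G)"
  shows "contains_copy G H"
proof -
  obtain f where f: "bij_betw f (verts H) R"
    using finite_same_card_bij[OF finite_verts[OF H] R(1)] R(3) by auto
  have fR: "f u \<in> R" if "u \<in> verts H" for u using f that by (auto simp: bij_betw_def)
  show ?thesis
  proof (rule contains_copyI[OF H])
    show inj: "inj_on f (verts H)" using f by (rule bij_betw_imp_inj_on)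
    show "f ` verts H \<subseteq> verts G" using fR R(2) by blast
    fix u v assume uv: "u \<in> verts H" "v \<in> verts H" "adj H u v"
    then have "u \<noteq> v" using adj_irrefl[OF H] by auto
    then have "f u \<noteq> f v" using inj uv by (auto dest: inj_onD)
    then show "adj G (f u) (f v)"
      using clique fR[OF uv(1)] fR[OF uv(2)] by (simp add: clique_def adj_def)
  qed
qed

text \<open>
Ramsey's theorem is applied inside each class: without a clique of size \<open>m\<close>, a class that is large
enough contains an independent set of size \<open>t\<close>.
\<close>
lemma blowup_with_independent_parts:
  fixes m t :: nat
  shows "\<exists>T. \<forall>(G :: 'a sgraph) S k A. finite S \<longrightarrow> blowup G S k T A \<longrightarrow>
    (\<nexists>R. R \<subseteq> S \<and> card R = m \<and> clique R (edges G)) \<longrightarrow>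
    (\<exists>B. blowup G S k t B \<and> (\<forall>i<k. indep (B i) (edges G)))"
proof -
  obtain T where T: "\<forall>(V :: 'a set) E. finite V \<and> T \<le> card V \<longrightarrow>
      (\<exists>R\<subseteq>V. card R = m \<and> clique R E \<or> card R = t \<and> indep R E)"
    using ramsey2[of m t, where ?'a = 'a] by blast
  have "\<exists>B. blowup G S k t B \<and> (\<forall>i<k. indep (B i) (edges G))"
    if S: "finite S" and A: "blowup G S k T A"
      and no: "\<nexists>R. R \<subseteq> S \<and> card R = m \<and> clique R (edges G)"
    for G :: "'a sgraph" and S k A
  proof -
    have "\<exists>R. R \<subseteq> A i \<and> card R = t \<and> indep R (edges G)" if i: "i < k" for i
    proof -
      have Ai: "A i \<subseteq> S" "card (A i) = T" using A i by (simp_all add: blowup_def)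
      then have "finite (A i)" using S finite_subset by blast
      then obtain R where "R \<subseteq> A i"
        "card R = m \<and> clique R (edges G) \<or> card R = t \<and> indep R (edges G)"
        using T Ai(2) by (metis order_refl)
      then show ?thesis using no order_trans[OF _ Ai(1)] by blast
    qed
    then obtain B where B: "B i \<subseteq> A i \<and> card (B i) = t \<and> indep (B i) (edges G)" if "i < k" for i
      by metis
    have "B i \<subseteq> S" if "i < k" for i using B[OF that] A that by (auto simp: blowup_def)
    moreover have "adj G a b" if "i < k" "j < k" "i \<noteq> j" "a \<in> B i" "b \<in> B j" for i j a b
      using A B[of i] B[of j] that unfolding blowup_def by blast
    ultimately show ?thesis using B by (intro exI[of _ B]) (simp add: blowup_def)
  qed
  then show ?thesis by blast
qed

text \<open>
Vertices in different classes are adjacent, so representatives of distinct classes have distinct colours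
under \<open>c\<close>. Recolouring each class with the colour of its representative gives a colouring with the
same colours whose colour classes are exactly the classes of the partition.
\<close>
lemma complete_multipartite_coloring:
  assumes F: "simple_graph F" "complete_multipartite F" and c: "proper_coloring F k c"
  obtains p where "p ` verts F \<subseteq> {..<k}"
    "\<And>u v. u \<in> verts F \<Longrightarrow> v \<in> verts F \<Longrightarrow> adj F u v \<longleftrightarrow> p u \<noteq> p v"
proof -
  obtain P where P: "partition_on (verts F) P" "\<forall>u\<in>verts F. \<forall>v\<in>verts F. u \<noteq> v \<longrightarrow>
      (adj F u v \<longleftrightarrow> \<not> (\<exists>A\<in>P. u \<in> A \<and> v \<in> A))"
    using F(2) unfolding complete_multipartite_def by blast
  have "\<exists>A\<in>P. v \<in> A" if "v \<in> verts F" for v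
    using that partition_onD1[OF P(1)] by blast
  then obtain part where part: "part v \<in> P" "v \<in> part v" if "v \<in> verts F" for v by metis
  have part_unique: "A = part v" if "v \<in> verts F" "A \<in> P" "v \<in> A" for v A
    using partition_onD2[OF P(1)] part[OF that(1)] that(2,3) by (auto simp: disjoint_def)
  have adj_iff: "adj F u v \<longleftrightarrow> part u \<noteq> part v" if "u \<in> verts F" "v \<in> verts F" for u v
  proof (cases "u = v")
    case True
    then show ?thesis using adj_irrefl[OF F(1)] by simp
  next
    case False
    have "(\<exists>A\<in>P. u \<in> A \<and> v \<in> A) \<longleftrightarrow> part u = part v"
      using part that part_unique by metis
    then show ?thesis using P(2) that False by metis
  qed
  define rep where "rep A = (SOME x. x \<in> A)" for A :: "'a set"
  have rep: "rep (part v) \<in> verts F" "part (rep (part v)) = part v" if v: "v \<in> verts F" for v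
  proof -
    have "rep (part v) \<in> part v"
      unfolding rep_def using part(2)[OF v] by (rule someI)
    then show "rep (part v) \<in> verts F" "part (rep (part v)) = part v"
      using part(1)[OF v] partition_onD1[OF P(1)] part_unique[of "rep (part v)" "part v"] by auto
  qed
  show thesis
  proof (rule that[of "\<lambda>v. c (rep (part v))"])
    show "(\<lambda>v. c (rep (part v))) ` verts F \<subseteq> {..<k}"
      using c rep(1) by (auto simp: proper_coloring_def)
    fix u v assume uv: "u \<in> verts F" "v \<in> verts F"
    show "adj F u v \<longleftrightarrow> c (rep (part u)) \<noteq> c (rep (part v))"
    proof
      assume "adj F u v"
      then have "adj F (rep (part u)) (rep (part v))"
        using adj_iff uv rep by simp
      then show "c (rep (part u)) \<noteq> c (rep (part v))"
        using c rep(1)[OF uv(1)] rep(1)[OF uv(2)] by (simp add: proper_coloring_def)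
    next
      assume "c (rep (part u)) \<noteq> c (rep (part v))"
      then show "adj F u v" using adj_iff[OF uv] by auto
    qed
  qed
qed

text \<open>
Adjacency in a complete multipartite graph means precisely a difference of colours. So the independence
of the classes turns the embedding along colours into an induced one.
\<close>
lemma contains_induced_copy_of_blowup:
  assumes G: "simple_graph G" and F: "simple_graph F" "complete_multipartite F"
    and c: "proper_coloring F k c"
    and A: "blowup G (verts G) k (card (verts F)) A" "\<And>i. i < k \<Longrightarrow> indep (A i) (edges G)"
  shows "contains_induced_copy G F"
proof -
  obtain p where p: "p ` verts F \<subseteq> {..<k}"
    "\<And>u v. u \<in> verts F \<Longrightarrow> v \<in> verts F \<Longrightarrow> adj F u v \<longleftrightarrow> p u \<noteq> p v"
    using complete_multipartite_coloring[OF F c] by blast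
  obtain f where f: "inj_on f (verts F)" "\<And>v. v \<in> verts F \<Longrightarrow> f v \<in> A (p v)"
    "\<And>u v. u \<in> verts F \<Longrightarrow> v \<in> verts F \<Longrightarrow> p u \<noteq> p v \<Longrightarrow> adj G (f u) (f v)"
    using blowup_transversal_embedding[OF G finite_verts[OF F(1)] A(1) p(1)] by blast
  have "\<not> adj G (f u) (f v)" if uv: "u \<in> verts F" "v \<in> verts F" "p u = p v" for u v
  proof (cases "f u = f v")
    case True
    then show ?thesis using adj_irrefl[OF G] by simp
  next
    case False
    have "p v < k" using p(1) uv(2) by auto
    then show ?thesis
      using A(2) f(2)[OF uv(1)] f(2)[OF uv(2)] uv(3) False by (auto simp: indep_def adj_def)
  qed
  moreover have "f v \<in> verts G" if "v \<in> verts F" for v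
    using f(2)[OF that] A(1) p(1) that by (auto simp: blowup_def)
  ultimately have "f ` verts F \<subseteq> verts G"
    "\<forall>u\<in>verts F. \<forall>v\<in>verts F. adj F u v \<longleftrightarrow> adj G (f u) (f v)"
    using f(3) p(2) by blast+
  then show ?thesis using f(1) unfolding contains_induced_copy_iff by blast
qed

section \<open>Turan graphs\<close>
definition turan_graph :: "nat \<Rightarrow> nat \<Rightarrow> nat sgraph" where
  "turan_graph k n = ({..<n}, {{u, v} | u v. u < n \<and> v < n \<and> u mod k \<noteq> v mod k})"

lemma verts_turan_graph [simp]: "verts (turan_graph k n) = {..<n}"
  by (simp add: turan_graph_def)

lemma adj_turan_graph:
  "adj (turan_graph k n) u v \<longleftrightarrow> u < n \<and> v < n \<and> u mod k \<noteq> v mod k"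
  by (auto simp: adj_def turan_graph_def doubleton_eq_iff)

lemma simple_graph_turan_graph: "simple_graph (turan_graph k n)"
  by (auto simp: simple_graph_def turan_graph_def card_2_iff)

lemma card_same_residue_less:
  assumes "1 \<le> k"
  shows "card {u. u < n \<and> u mod k = n mod k} \<le> n div k"
proof -
  have "inj_on (\<lambda>u. u div k) {u. u < n \<and> u mod k = n mod k}"
    by (rule inj_onI) (metis (mono_tags, lifting) div_mult_mod_eq mem_Collect_eq)
  moreover have "(\<lambda>u. u div k) ` {u. u < n \<and> u mod k = n mod k} \<subseteq> {..<n div k}"
  proof
    fix q assume "q \<in> (\<lambda>u. u div k) ` {u. u < n \<and> u mod k = n mod k}"
    then obtain u where u: "u < n" "u mod k = n mod k" "q = u div k" by blast
    then have "u div k \<noteq> n div k" by (metis div_mult_mod_eq less_irrefl)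
    then show "q \<in> {..<n div k}" using u div_le_mono[of u n k] by simp
  qed
  ultimately show ?thesis by (metis card_inj_on_le card_lessThan finite_lessThan)
qed

text \<open>
Of the \<open>n\<close> vertices before vertex \<open>n\<close>, at most \<open>n div k\<close> lie in its class. Hence adding vertex \<open>n\<close>
creates at least the proportion \<open>1 - 1 / k\<close> of all \<open>n\<close> new pairs, and no error term arises.
\<close>
lemma card_edges_turan_graph:
  assumes k: "1 \<le> k"
  shows "(1 - 1 / k) * (n choose 2) \<le> card (edges (turan_graph k n))"
proof (induction n)
  case (Suc n)
  let ?U = "{u. u < n \<and> u mod k \<noteq> n mod k}" and ?E = "edges (turan_graph k n)"
  have fin: "finite ?E" by (rule finite_edges[OF simple_graph_turan_graph])
  have "?E \<union> (\<lambda>u. {u, n}) ` ?U \<subseteq> edges (turan_graph k (Suc n))"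
    by (fastforce simp: turan_graph_def)
  then have "card (?E \<union> (\<lambda>u. {u, n}) ` ?U) \<le> card (edges (turan_graph k (Suc n)))"
    by (rule card_mono[OF finite_edges[OF simple_graph_turan_graph]])
  moreover have "card (?E \<union> (\<lambda>u. {u, n}) ` ?U) = card ?E + card ((\<lambda>u. {u, n}) ` ?U)"
    using fin by (intro card_Un_disjoint) (auto simp: turan_graph_def doubleton_eq_iff)
  moreover have "card ((\<lambda>u. {u, n}) ` ?U) = card ?U"
    by (intro card_image) (auto simp: inj_on_def doubleton_eq_iff)
  ultimately have step: "card ?E + card ?U \<le> card (edges (turan_graph k (Suc n)))" by simp
  have "{..<n} = ?U \<union> {u. u < n \<and> u mod k = n mod k}" by auto
  then have "n \<le> card ?U + card {u. u < n \<and> u mod k = n mod k}"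
    by (metis card_Un_le card_lessThan)
  then have "n \<le> card ?U + n div k" using card_same_residue_less[OF k, of n] by linarith
  then have "real n \<le> card ?U + real (n div k)"
    unfolding of_nat_add[symmetric] of_nat_le_iff .
  moreover have "real (n div k) \<le> n / k" by (rule of_nat_div_le_of_nat)
  ultimately have U: "(1 - 1 / k) * n \<le> card ?U" by (simp add: algebra_simps)
  have "Suc n choose 2 = (n choose 2) + n" by (simp add: numeral_2_eq_2)
  then have "(1 - 1 / k) * (Suc n choose 2) = (1 - 1 / k) * (n choose 2) + (1 - 1 / k) * n"
    by (simp add: algebra_simps)
  also have "\<dots> \<le> card ?E + card ?U" using Suc U by simp
  also have "\<dots> \<le> card (edges (turan_graph k (Suc n)))" using step by simp
  finally show ?case .
qed (simp add: binomial_eq_0)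

lemma proper_coloring_of_hom_turan_graph:
  assumes "1 \<le> k" "f ` verts H \<subseteq> {..<n}"
    and "\<And>u v. u \<in> verts H \<Longrightarrow> v \<in> verts H \<Longrightarrow> adj H u v \<Longrightarrow> adj (turan_graph k n) (f u) (f v)"
  shows "chromatic_number H \<le> k"
proof (rule chromatic_number_le)
  show "proper_coloring H k (\<lambda>v. f v mod k)"
    using assms by (auto simp: proper_coloring_def adj_turan_graph)
qed

lemma turan_graph_no_copy:
  assumes "1 \<le> k" "k < chromatic_number H"
  shows "\<not> contains_copy (turan_graph k n) H"
proof
  assume "contains_copy (turan_graph k n) H"
  then obtain f where "f ` verts H \<subseteq> verts (turan_graph k n)"
    "\<And>u v. u \<in> verts H \<Longrightarrow> v \<in> verts H \<Longrightarrow> adj H u v \<Longrightarrow> adj (turan_graph k n) (f u) (f v)"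
    by (rule contains_copyE) blast
  then show False
    using proper_coloring_of_hom_turan_graph[of k f H n] assms by simp
qed

lemma complete_multipartiteI:
  assumes "\<And>u v. u \<in> verts F \<Longrightarrow> v \<in> verts F \<Longrightarrow> adj F u v \<longleftrightarrow> g u \<noteq> g v"
  shows "complete_multipartite F"
proof -
  let ?P = "(\<lambda>x. {v \<in> verts F. g v = x}) ` g ` verts F"
  have "partition_on (verts F) ?P"
    by (rule partition_onI) (auto simp: disjnt_def)
  moreover have "(\<exists>A\<in>?P. u \<in> A \<and> v \<in> A) \<longleftrightarrow> g u = g v"
    if "u \<in> verts F" "v \<in> verts F" for u v using that by auto
  ultimately show ?thesis
    unfolding complete_multipartite_def using assms by (intro exI[of _ ?P]) simp
qed

text \<open>
The colouring by residues pulls back along an induced copy to a colouring of \<open>F\<close> under which adjacency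
is equivalent to a difference of colours. Its existence shows both that \<open>F\<close> is \<open>k\<close>-colourable and that
\<open>F\<close> is complete multipartite.
\<close>
lemma turan_graph_no_induced_copy:
  assumes "1 \<le> k" "k < chromatic_number F \<or> \<not> complete_multipartite F"
  shows "\<not> contains_induced_copy (turan_graph k n) F"
proof
  assume "contains_induced_copy (turan_graph k n) F"
  then obtain f where f: "f ` verts F \<subseteq> {..<n}" 
    "\<forall>u\<in>verts F. \<forall>v\<in>verts F. adj F u v \<longleftrightarrow> adj (turan_graph k n) (f u) (f v)"
    unfolding contains_induced_copy_iff by auto
  then have "chromatic_number F \<le> k"
    using assms(1) proper_coloring_of_hom_turan_graph[of k f F n] by simp
  moreover have "complete_multipartite F"
    using f by (intro complete_multipartiteI[of F "\<lambda>v. f v mod k"]) (auto simp: adj_turan_graph)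
  ultimately show False using assms(2) by simp
qed

section \<open>Asymptotics of the induced Turan number\<close>
lemma induced_turan_values:
  fixes H :: "'a sgraph" and F :: "'b sgraph"
  defines "X \<equiv> \<lambda>n. {card (edges G) | G :: nat sgraph. simple_graph G \<and> card (verts G) = n \<and>
    \<not> contains_copy G H \<and> \<not> contains_induced_copy G F}"
  shows "induced_turan n H F = Max (X n)" "finite (X n)"
proof -
  show "induced_turan n H F = Max (X n)" by (simp add: X_def induced_turan_def)
  have "X n \<subseteq> {..n choose 2}" using card_edges_le_choose_two by (auto simp: X_def)
  then show "finite (X n)" by (rule finite_subset) simp
qed

lemma card_edges_le_induced_turan:
  fixes G :: "nat sgraph"
  assumes "simple_graph G" "\<not> contains_copy G H" "\<not> contains_induced_copy G F"
  shows "card (edges G) \<le> induced_turan (card (verts G)) H F"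
  unfolding induced_turan_values(1)
  by (rule Max_ge[OF induced_turan_values(2)]) (use assms in blast)

lemma induced_turan_attained:
  fixes G\<^sub>0 :: "nat sgraph"
  assumes "simple_graph G\<^sub>0" "card (verts G\<^sub>0) = n"
    "\<not> contains_copy G\<^sub>0 H" "\<not> contains_induced_copy G\<^sub>0 F"
  obtains G :: "nat sgraph" where "simple_graph G" "card (verts G) = n"
    "\<not> contains_copy G H" "\<not> contains_induced_copy G F" "card (edges G) = induced_turan n H F"
proof -
  have "induced_turan n H F \<in> {card (edges G) | G :: nat sgraph. simple_graph G \<and>
      card (verts G) = n \<and> \<not> contains_copy G H \<and> \<not> contains_induced_copy G F}"
    unfolding induced_turan_values(1)
    by (rule Max_in[OF induced_turan_values(2)]) (use assms in blast)
  then show thesis using that by fastforce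
qed

text \<open>
The two cases of the theorem differ only in the number \<open>k\<close> of classes. In both, the Turan graph is
admissible, while no admissible graph contains a certain complete \<open>(k + 1)\<close>-partite configuration.
\<close>
lemma induced_turan_asymptotics:
  fixes H :: "'a sgraph" and F :: "'b sgraph"
  assumes k: "1 \<le> k"
    and lower: "\<And>n. \<not> contains_copy (turan_graph k n) H"
      "\<And>n. \<not> contains_induced_copy (turan_graph k n) F"
    and upper: "\<And>(G :: nat sgraph) A. simple_graph G \<Longrightarrow> \<not> contains_copy G H \<Longrightarrow>
      \<not> contains_induced_copy G F \<Longrightarrow> \<not> blowup G (verts G) (Suc k) t A"
  shows "\<exists>\<epsilon> :: nat \<Rightarrow> real. \<epsilon> \<in> o(\<lambda>_. 1) \<and>
    (\<forall>n>0. real (induced_turan n H F) = (1 - 1 / real k + \<epsilon> n) * real (n choose 2))"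
proof -
  have attained: "\<exists>G :: nat sgraph. simple_graph G \<and> card (verts G) = n \<and>
      \<not> contains_copy G H \<and> \<not> contains_induced_copy G F \<and> card (edges G) = induced_turan n H F"
    for n
    using induced_turan_attained[OF simple_graph_turan_graph[of k n], of n H F] lower
    by (metis card_lessThan verts_turan_graph)
  have ge: "(1 - 1 / k) * (n choose 2) \<le> induced_turan n H F" for n
  proof -
    have "card (edges (turan_graph k n)) \<le> induced_turan n H F"
      using card_edges_le_induced_turan[OF simple_graph_turan_graph lower, of n] by simp
    then show ?thesis using card_edges_turan_graph[OF k, of n] by linarith
  qed
  have le: "\<forall>\<^sub>F n in sequentially. induced_turan n H F \<le> (1 - 1 / k + \<delta>) * (n choose 2)"
    if \<delta>: "0 < \<delta>" for \<delta> :: real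
  proof -
    obtain N where N: "\<forall>G :: nat sgraph. simple_graph G \<longrightarrow> N \<le> card (verts G) \<longrightarrow>
        (\<nexists>A. blowup G (verts G) (Suc k) t A) \<longrightarrow>
        card (edges G) \<le> (1 - 1 / k + \<delta>) * (card (verts G) choose 2)"
      using erdos_stone[OF k \<delta>] by blast
    have "induced_turan n H F \<le> (1 - 1 / k + \<delta>) * (n choose 2)" if n: "N \<le> n" for n
    proof -
      obtain G :: "nat sgraph" where G: "simple_graph G" "card (verts G) = n"
        "\<not> contains_copy G H" "\<not> contains_induced_copy G F" "card (edges G) = induced_turan n H F"
        using attained[of n] by blast
      then show ?thesis using N upper[OF G(1,3,4)] n by metis
    qed
    then show ?thesis by (auto simp: eventually_sequentially)
  qed
  \<comment> \<open>For \<open>n = 1\<close> the binomial coefficient vanishes; there the equation holds because both sides are \<open>0\<close>.\<close>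
  define \<epsilon> where "\<epsilon> n = real (induced_turan n H F) / (n choose 2) - (1 - 1 / k)" for n
  have pos: "0 < real (n choose 2)" if "2 \<le> n" for n
    using that by (simp add: zero_less_binomial_iff)
  have "\<epsilon> \<longlonglongrightarrow> 0"
  proof (rule LIMSEQ_I)
    fix \<delta> :: real assume \<delta>: "0 < \<delta>"
    then obtain N where N: "\<forall>n\<ge>N. induced_turan n H F \<le> (1 - 1 / k + \<delta> / 2) * (n choose 2)"
      using le[of "\<delta> / 2"] by (auto simp: eventually_sequentially)
    have "norm (\<epsilon> n - 0) < \<delta>" if n: "max 2 N \<le> n" for n
    proof -
      have p: "0 < real (n choose 2)" using pos n by simp
      have "0 \<le> \<epsilon> n" using ge[of n] p by (simp add: \<epsilon>_def pos_le_divide_eq)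
      moreover have "real (induced_turan n H F) / (n choose 2) \<le> 1 - 1 / k + \<delta> / 2"
        using N n p by (simp add: pos_divide_le_eq)
      ultimately show ?thesis using \<delta> by (simp add: \<epsilon>_def)
    qed
    then show "\<exists>N0. \<forall>n\<ge>N0. norm (\<epsilon> n - 0) < \<delta>" by blast
  qed
  then have "\<epsilon> \<in> o(\<lambda>_. 1)" by (intro smalloI_tendsto) auto
  moreover have "real (induced_turan n H F) = (1 - 1 / k + \<epsilon> n) * (n choose 2)" if "0 < n" for n
  proof (cases "2 \<le> n")
    case True
    then show ?thesis using pos[of n] by (simp add: \<epsilon>_def)
  next
    case False
    then have "n choose 2 = 0" by simp
    moreover obtain G :: "nat sgraph" where "simple_graph G" "card (verts G) = n"
      "card (edges G) = induced_turan n H F"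
      using attained[of n] by blast
    ultimately have "induced_turan n H F = 0"
      using card_edges_le_choose_two[of G] by (metis le_zero_eq)
    then show ?thesis using \<open>n choose 2 = 0\<close> by simp
  qed
  ultimately show ?thesis by blast
qed

theorem theorem1:
  fixes H :: "'a sgraph" and F :: "'b sgraph" and r s :: nat
  assumes "simple_graph H" and "simple_graph F"
    and "chromatic_number H = r + 1" and "chromatic_number F = s + 1"
    and "r \<ge> 1" and "s \<ge> 1"
  shows "(s \<ge> r \<or> \<not> complete_multipartite F \<longrightarrow>
           (\<exists>\<epsilon> :: nat \<Rightarrow> real. \<epsilon> \<in> o(\<lambda>_. 1) \<and>
             (\<forall>n>0. real (induced_turan n H F) =
                (1 - 1 / real r + \<epsilon> n) * real (n choose 2)))) \<and>
         (s < r \<and> complete_multipartite F \<longrightarrow>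
           (\<exists>\<epsilon> :: nat \<Rightarrow> real. \<epsilon> \<in> o(\<lambda>_. 1) \<and>
             (\<forall>n>0. real (induced_turan n H F) =
                (1 - 1 / real s + \<epsilon> n) * real (n choose 2))))"
proof (intro conjI impI)
  obtain c where c: "proper_coloring H (Suc r) c"
    using proper_coloring_chromatic_number[OF assms(1)] assms(3) by auto
  assume "s \<ge> r \<or> \<not> complete_multipartite F"
  then show "\<exists>\<epsilon> :: nat \<Rightarrow> real. \<epsilon> \<in> o(\<lambda>_. 1) \<and>
      (\<forall>n>0. real (induced_turan n H F) = (1 - 1 / real r + \<epsilon> n) * real (n choose 2))"
    using assms contains_copy_of_blowup[OF _ assms(1) c]
    by (intro induced_turan_asymptotics[where t = "card (verts H)"]
        turan_graph_no_copy turan_graph_no_induced_copy) auto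
next
  obtain c where c: "proper_coloring F (Suc s) c"
    using proper_coloring_chromatic_number[OF assms(2)] assms(4) by auto
  obtain T where T: "\<exists>B. blowup G S k (card (verts F)) B \<and> (\<forall>i<k. indep (B i) (edges G))"
    if "finite S" "blowup G S k T A"
      "\<nexists>R. R \<subseteq> S \<and> card R = card (verts H) \<and> clique R (edges G)"
    for G :: "nat sgraph" and S k A
    using blowup_with_independent_parts[of "card (verts H)" "card (verts F)", where ?'a = nat]
    by metis
  assume F: "s < r \<and> complete_multipartite F"
  \<comment> \<open>A clique on as many vertices as \<open>H\<close> contains \<open>H\<close>, so the Ramsey alternative of a clique is excluded.\<close>
  have "contains_induced_copy G F"
    if G: "simple_graph G" "\<not> contains_copy G H" and A: "blowup G (verts G) (Suc s) T A"
    for G :: "nat sgraph" and A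
  proof -
    have "\<not> clique R (edges G)" if "R \<subseteq> verts G" "card R = card (verts H)" for R
      using contains_copy_of_clique[OF assms(1) finite_subset[OF that(1) finite_verts[OF G(1)]] that]
        G(2) by blast
    then obtain B where "blowup G (verts G) (Suc s) (card (verts F)) B"
      "\<forall>i<Suc s. indep (B i) (edges G)"
      using T[OF finite_verts[OF G(1)] A] by blast
    then show ?thesis
      using contains_induced_copy_of_blowup[OF G(1) assms(2) _ c] F by blast
  qed
  then show "\<exists>\<epsilon> :: nat \<Rightarrow> real. \<epsilon> \<in> o(\<lambda>_. 1) \<and>
      (\<forall>n>0. real (induced_turan n H F) = (1 - 1 / real s + \<epsilon> n) * real (n choose 2))"
    using assms F
    by (intro induced_turan_asymptotics[where t = T]
        turan_graph_no_copy turan_graph_no_induced_copy) auto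
qed

end
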